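(* There exists a Steiner system $S(3,6,42)$.
   Context: A Steiner system $S(t,k,v)$ is a pair $(X,\mathcal{B})$ where $X$ is a set of $v$ points and $\mathcal{B}$ is a family of $k$-element subsets of $X$ (blocks) such that every $t$-subset of $X$ is contained in exactly one block. *)

theory Defs
  imports Main
begin

definition steiner_system :: "nat \<Rightarrow> nat \<Rightarrow> nat \<Rightarrow> 'a set \<Rightarrow> 'a set set \<Rightarrow> bool" where
  "steiner_system t k v X \<B> \<longleftrightarrow>
     finite X \<and> card X = v \<and>
     (\<forall>B\<in>\<B>. B \<subseteq> X \<and> card B = k) \<and>
     (\<forall>T. T \<subseteq> X \<and> card T = t \<longrightarrow> (\<exists>!B. B \<in> \<B> \<and> T \<subseteq> B))"

end

theory Submission
  imports Defs "HOL-Library.While_Combinator" "HOL-Library.Code_Binary_Nat"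
begin

text \<open>
  The design was found by a computer search among the systems invariant under a prescribed group:
  two permutations \<open>alpha\<close> and \<open>beta\<close> generate a group of order 72 with three orbits on the
  42 points, and the blocks are the images of 19 base blocks. By symmetry it suffices to check
  that the triples through one representative of each point orbit are covered. Since there are
  only 574 blocks and 574 * 20 = 11480 is the number of all triples, no triple can then be
  covered twice.
\<close>

section \<open>From coverings to Steiner systems by counting\<close>

lemma steiner_system_if_covers:
  assumes X: "finite X" "card X = v"
    and blocks: "finite \<B>" "\<And>B. B \<in> \<B> \<Longrightarrow> B \<subseteq> X \<and> card B = k"
    and covers: "\<And>T. T \<subseteq> X \<Longrightarrow> card T = t \<Longrightarrow> \<exists>B\<in>\<B>. T \<subseteq> B"
    and count: "card \<B> * (k choose t) \<le> v choose t"
  shows "steiner_system t k v X \<B>"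
proof -
  define \<T> where "\<T> = {T. T \<subseteq> X \<and> card T = t}"
  define r where "r T = card {B \<in> \<B>. T \<subseteq> B}" for T
  have fin: "finite \<T>"
    using X(1) by (simp add: \<T>_def)
  have r_pos: "1 \<le> r T" if "T \<in> \<T>" for T
  proof -
    have "\<exists>B\<in>\<B>. T \<subseteq> B"
      using that by (intro covers) (auto simp: \<T>_def)
    then have "{B \<in> \<B>. T \<subseteq> B} \<noteq> {}" by blast
    then show ?thesis
      using blocks(1) by (simp add: r_def Suc_le_eq card_gt_0_iff)
  qed
  \<comment> \<open>Double counting of the pairs with \<open>T \<subseteq> B\<close>: each block
    contributes k choose t of them, so \<open>count\<close> bounds the total by the number of
    t-subsets of \<open>X\<close>. As every \<open>r T\<close> is at least 1, none can exceed
    1.\<close>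
  have "(\<Sum>T\<in>\<T>. r T) = (\<Sum>T\<in>\<T>. \<Sum>B\<in>\<B>. if T \<subseteq> B then 1 else 0)"
    using blocks(1) by (simp add: r_def sum.If_cases Int_def)
  also have "\<dots> = (\<Sum>B\<in>\<B>. \<Sum>T\<in>\<T>. if T \<subseteq> B then 1 else 0)"
    by (rule sum.swap)
  also have "\<dots> = (\<Sum>B\<in>\<B>. card {T \<in> \<T>. T \<subseteq> B})"
    using fin by (simp add: sum.If_cases Int_def)
  also have "\<dots> = (\<Sum>B\<in>\<B>. k choose t)"
  proof (rule sum.cong)
    fix B assume B: "B \<in> \<B>"
    have "{T \<in> \<T>. T \<subseteq> B} = {T. T \<subseteq> B \<and> card T = t}"
      using blocks(2)[OF B] by (auto simp: \<T>_def)
    then show "card {T \<in> \<T>. T \<subseteq> B} = k choose t"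
      using blocks(2)[OF B] X(1) n_subsets[of B t] finite_subset[of B X] by simp
  qed simp
  also have "\<dots> \<le> v choose t"
    using count by simp
  also have "\<dots> = (\<Sum>T\<in>\<T>. 1)"
    using n_subsets[OF X(1), of t] X(2) by (simp add: \<T>_def)
  finally have le: "(\<Sum>T\<in>\<T>. r T) \<le> (\<Sum>T\<in>\<T>. 1)" .
  have r_one: "r T = 1" if "T \<in> \<T>" for T
  proof (rule ccontr)
    assume "r T \<noteq> 1"
    with r_pos[OF that] have "1 < r T" by simp
    then have "(\<Sum>T\<in>\<T>. 1) < (\<Sum>T\<in>\<T>. r T)"
      using fin that r_pos by (intro sum_strict_mono_ex1) auto
    with le show False by simp
  qed
  have "\<exists>!B. B \<in> \<B> \<and> T \<subseteq> B" if T: "T \<subseteq> X" "card T = t" for T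
  proof -
    have "card {B \<in> \<B>. T \<subseteq> B} = 1"
      using r_one[of T] T by (simp add: r_def \<T>_def)
    then obtain C where C: "{B \<in> \<B>. T \<subseteq> B} = {C}"
      by (rule card_1_singletonE)
    show ?thesis
    proof (rule ex1I)
      show "C \<in> \<B> \<and> T \<subseteq> C"
        using C by auto
      show "B = C" if "B \<in> \<B> \<and> T \<subseteq> B" for B
        using C that by auto
    qed
  qed
  then show ?thesis
    using X blocks(2) by (simp add: steiner_system_def)
qed

section \<open>Orbits under a list of maps, by depth-first search\<close>

definition orbit_step :: "('a \<Rightarrow> 'a) list \<Rightarrow> 'a list \<times> 'a list \<Rightarrow> 'a list \<times> 'a list" where
  "orbit_step fs S = (case S of (ws, zs) \<Rightarrow>
     if hd ws \<in> set zs then (tl ws, zs) else (map (\<lambda>f. f (hd ws)) fs @ tl ws, hd ws # zs))"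

text \<open>
  The junk value \<open>[]\<close> for a search that does not terminate makes the next two lemmas hold
  without a termination argument.
\<close>

definition orbit :: "('a \<Rightarrow> 'a) list \<Rightarrow> 'a \<Rightarrow> 'a list" where
  "orbit fs x = (case while_option (\<lambda>S. fst S \<noteq> []) (orbit_step fs) ([x], []) of
     None \<Rightarrow> [] | Some S \<Rightarrow> snd S)"

text \<open>The search state consists of a stack of pending elements and a list of visited ones.
  Every image of a visited element is visited or pending, and at the end nothing is pending.\<close>

lemma orbit_closed:
  assumes "f \<in> set fs" and "y \<in> set (orbit fs x)"
  shows "f y \<in> set (orbit fs x)"
proof (cases "while_option (\<lambda>S. fst S \<noteq> []) (orbit_step fs) ([x], [])")
  case None
  with assms show ?thesis by (simp add: orbit_def)
next
  case (Some S)
  have "\<forall>z\<in>set (snd S). \<forall>f\<in>set fs. f z \<in> set (snd S) \<union> set (fst S)"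
  proof (rule while_option_rule[OF _ Some])
    fix S :: "'a list \<times> 'a list"
    assume "\<forall>z\<in>set (snd S). \<forall>f\<in>set fs. f z \<in> set (snd S) \<union> set (fst S)" "fst S \<noteq> []"
    then show "\<forall>z\<in>set (snd (orbit_step fs S)). \<forall>f\<in>set fs.
        f z \<in> set (snd (orbit_step fs S)) \<union> set (fst (orbit_step fs S))"
      by (cases S; cases "fst S") (auto simp: orbit_step_def)
  qed simp
  moreover have "fst S = []"
    using while_option_stop[OF Some] by simp
  ultimately show ?thesis
    using assms Some by (simp add: orbit_def)
qed

text \<open>All pending and visited elements arise from \<open>x\<close> by applying maps of
  \<open>fs\<close>, so \<open>P\<close> is an invariant of the search.\<close>

lemma orbit_induct:
  assumes "y \<in> set (orbit fs x)"
    and base: "P x" and step: "\<And>f z. f \<in> set fs \<Longrightarrow> P z \<Longrightarrow> P (f z)"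
  shows "P y"
proof (cases "while_option (\<lambda>S. fst S \<noteq> []) (orbit_step fs) ([x], [])")
  case None
  with assms show ?thesis by (simp add: orbit_def)
next
  case (Some S)
  have "\<forall>z \<in> set (fst S) \<union> set (snd S). P z"
  proof (rule while_option_rule[OF _ Some])
    fix S :: "'a list \<times> 'a list"
    assume "\<forall>z \<in> set (fst S) \<union> set (snd S). P z" "fst S \<noteq> []"
    then show "\<forall>z \<in> set (fst (orbit_step fs S)) \<union> set (snd (orbit_step fs S)). P z"
      by (cases S; cases "fst S") (auto simp: orbit_step_def intro: step)
  qed (simp add: base)
  with assms Some show ?thesis by (simp add: orbit_def)
qed

section \<open>The permutations, the base blocks and the finite checks\<close>

definition alpha :: "nat \<Rightarrow> nat" where
  "alpha x =
    (if x < 36 then if x \<in> set [5, 11, 17, 23, 29, 35] then x - 5 else x + 1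
     else [37, 36, 39, 38, 40, 41] ! (x - 36))"

text \<open>While \<open>alpha\<close> has the six 6-cycles (0..5), ..., (30..35), swaps 36 with 37
  and 38 with 39, and fixes 40 and 41, \<open>beta\<close> is an involution with fixed points 24 and
  34 that links these cycles into larger orbits.\<close>

definition beta :: "nat \<Rightarrow> nat" where
  "beta x =
    (if x < 6 then [1, 0, 14, 9, 10, 13] ! x
     else if x < 12 then [7, 6, 17, 3, 4, 16] ! (x - 6)
     else if x < 18 then [15, 5, 2, 12, 11, 8] ! (x - 12)
     else if x < 24 then [36, 39, 41, 38, 37, 40] ! (x - 18)
     else if x < 30 then [24, 35, 28, 31, 26, 33] ! (x - 24)
     else if x < 36 then [32, 27, 30, 29, 34, 25] ! (x - 30)
     else [18, 22, 21, 19, 23, 20] ! (x - 36))"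

text \<open>Sorting gives each block a canonical list, so that the orbit search recognises a block
  reached twice. The base blocks are sorted as well.\<close>

definition act :: "(nat \<Rightarrow> nat) \<Rightarrow> nat list \<Rightarrow> nat list" where
  "act f B = sort (map f B)"

definition base_blocks :: "nat list list" where
  "base_blocks =
   [[18, 19, 20, 21, 22, 23], [24, 26, 28, 30, 32, 34], [0, 1, 6, 7, 12, 15],
    [0, 2, 4, 6, 8, 10], [0, 6, 18, 21, 37, 39], [0, 6, 26, 27, 30, 31],
    [0, 1, 2, 14, 25, 35], [0, 3, 7, 10, 40, 41], [18, 19, 25, 35, 37, 40],
    [18, 21, 24, 25, 32, 33], [0, 1, 3, 17, 27, 33], [0, 1, 4, 16, 21, 22],
    [0, 1, 19, 26, 28, 39], [0, 3, 26, 29, 36, 37], [0, 6, 19, 20, 29, 35],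
    [0, 1, 18, 20, 32, 40], [0, 2, 7, 31, 34, 36], [0, 2, 9, 19, 27, 37],
    [0, 3, 25, 32, 34, 39]]"

definition block_orbits :: "nat list list list" where
  "block_orbits = map (orbit [act alpha, act beta]) base_blocks"

definition blocks :: "nat set set" where
  "blocks = set ` set (concat block_orbits)"

definition through :: "nat \<Rightarrow> nat list list \<Rightarrow> nat list list" where
  "through x Bs = filter (\<lambda>B. x \<in> set B) Bs"

text \<open>The blocks are narrowed first by \<open>x\<close> and then by \<open>y\<close>, so that
  \<open>z\<close> is looked up only in blocks through both. Pairs containing \<open>x\<close> add
  no real demand: a block through a triple contains its pairs.\<close>

definition covers_at :: "nat list list list \<Rightarrow> nat \<Rightarrow> bool" where
  "covers_at Bss x \<longleftrightarrow> (\<forall>y\<in>set [0..<42]. \<forall>z\<in>set [0..<y].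
     z \<in> set (concat (through y (concat (map (through x) Bss)))))"

text \<open>
  The conditions are bundled so that the expensive computation of the orbits happens only once.
\<close>

definition count_and_covers :: "nat list list list \<Rightarrow> bool" where
  "count_and_covers Bss \<longleftrightarrow> sum_list (map length Bss) = 574 \<and>
     covers_at Bss 0 \<and> covers_at Bss 18 \<and> covers_at Bss 24"

lemma count_and_covers_block_orbits: "count_and_covers block_orbits"
  by code_simp

text \<open>An injective self-map of a finite set is onto. Both assumptions can be decided by
  evaluation.\<close>

lemma bij_betw_lessThan_if_distinct_map:
  assumes "distinct (map f [0..<n])" and "\<forall>x\<in>set [0..<n]. f x < n"
  shows "bij_betw f {..<n} {..<n}"
proof -
  have "inj_on f {..<n}"
    using assms(1) by (simp add: distinct_map lessThan_atLeast0)
  moreover have "f ` {..<n} \<subseteq> {..<n}"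
    using assms(2) by auto
  ultimately show ?thesis
    by (simp add: bij_betw_def endo_inj_surj)
qed

lemma bij_betw_alpha: "bij_betw alpha {..<42} {..<42}"
  by (rule bij_betw_lessThan_if_distinct_map; code_simp)

lemma bij_betw_beta: "bij_betw beta {..<42} {..<42}"
  by (rule bij_betw_lessThan_if_distinct_map; code_simp)

text \<open>The orbits of 0, 18 and 24 are {0..17}, {18..23} with {36..41}, and {24..35}.\<close>

lemma point_orbits:
  "\<forall>x\<in>set [0..<42]. x \<in> set (concat (map (orbit [alpha, beta]) [0, 18, 24]))"
  by code_simp

section \<open>The family of blocks: size, invariance, shape\<close>

lemma finite_blocks: "finite blocks"
  by (simp add: blocks_def)

text \<open>The counting argument asks only for an upper bound, so the total length of the orbit
  lists suffices, whether or not they overlap.\<close>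

lemma card_blocks: "card blocks \<le> 574"
proof -
  have "card blocks \<le> card (set (concat block_orbits))"
    unfolding blocks_def by (rule card_image_le) simp
  also have "\<dots> \<le> length (concat block_orbits)"
    by (rule card_length)
  also have "\<dots> = 574"
    using count_and_covers_block_orbits by (simp add: count_and_covers_def length_concat)
  finally show ?thesis .
qed

lemma image_in_blocks:
  assumes "f \<in> {alpha, beta}" and "B \<in> blocks"
  shows "f ` B \<in> blocks"
proof -
  obtain C B0 where C: "C \<in> set (orbit [act alpha, act beta] B0)" "B = set C"
    and B0: "B0 \<in> set base_blocks"
    using assms(2) by (auto simp: blocks_def block_orbits_def)
  have "act f C \<in> set (orbit [act alpha, act beta] B0)"
    using assms(1) C(1) by (auto intro: orbit_closed)
  moreover have "set (act f C) = f ` B"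
    using C(2) by (simp add: act_def)
  ultimately show ?thesis
    using B0 by (force simp: blocks_def block_orbits_def)
qed

lemma base_blocks_wf:
  "\<forall>B\<in>set base_blocks. length B = 6 \<and> distinct B \<and> (\<forall>x\<in>set B. x < 42)"
  by code_simp

text \<open>The base blocks are 6-subsets of the points, and bijections of the points preserve this
  along each orbit.\<close>

lemma blocks_wf:
  assumes "B \<in> blocks"
  shows "B \<subseteq> {..<42} \<and> card B = 6"
proof -
  obtain C B0 where C: "C \<in> set (orbit [act alpha, act beta] B0)" "B = set C"
    and B0: "B0 \<in> set base_blocks"
    using assms by (auto simp: blocks_def block_orbits_def)
  from C(1) have "set C \<subseteq> {..<42} \<and> card (set C) = 6"
  proof (rule orbit_induct)
    show "set B0 \<subseteq> {..<42} \<and> card (set B0) = 6"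
      using base_blocks_wf B0 by (auto simp: distinct_card)
  next
    fix g and D :: "nat list"
    assume "g \<in> set [act alpha, act beta]" and D: "set D \<subseteq> {..<42} \<and> card (set D) = 6"
    then obtain f where f: "g = act f" "bij_betw f {..<42::nat} {..<42}"
      using bij_betw_alpha bij_betw_beta by auto
    have "f ` set D \<subseteq> {..<42}"
      using D f(2) by (auto simp: bij_betw_def)
    moreover have "card (f ` set D) = 6"
      using D f(2) by (metis bij_betw_def card_image inj_on_subset)
    ultimately show "set (g D) \<subseteq> {..<42} \<and> card (set (g D)) = 6"
      by (simp add: f(1) act_def)
  qed
  with C(2) show ?thesis by simp
qed

section \<open>Covering all triples by symmetry\<close>

definition covered_at :: "nat \<Rightarrow> bool" where
  "covered_at x \<longleftrightarrow> (\<forall>T. T \<subseteq> {..<42} \<longrightarrow> card T = 3 \<longrightarrow> x \<in> T \<longrightarrow> (\<exists>B\<in>blocks. T \<subseteq> B))"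

lemma covered_at_if_covers_at:
  assumes "covers_at block_orbits x"
  shows "covered_at x"
  unfolding covered_at_def
proof (intro allI impI)
  fix T :: "nat set"
  assume T: "T \<subseteq> {..<42}" "card T = 3" "x \<in> T"
  have "card (T - {x}) = 2"
    using T by (simp add: card_Diff_singleton)
  then obtain a b where ab: "T - {x} = {a, b}" "a \<noteq> b"
    by (auto simp: card_2_iff)
  \<comment> \<open>The check runs over pairs with \<open>z < y\<close> only, so the two remaining
    points are put in order.\<close>
  define y z where "y = max a b" and "z = min a b"
  have yz: "T = {x, y, z}" "z < y"
    using ab T(3) by (auto simp: y_def z_def max_def min_def)
  then have "y < 42" using T(1) by auto
  then have "z \<in> set (concat (through y (concat (map (through x) block_orbits))))"
    using assms yz(2) unfolding covers_at_def by simp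
  then obtain C where "C \<in> set (concat block_orbits)" "x \<in> set C" "y \<in> set C" "z \<in> set C"
    by (auto simp: through_def)
  then show "\<exists>B\<in>blocks. T \<subseteq> B"
    unfolding blocks_def yz(1) by blast
qed

text \<open>A triple through \<open>f x\<close> is pulled back along the bijection \<open>f\<close>
  to a triple through \<open>x\<close>. A block around the latter is mapped by \<open>f\<close> to a
  block around the former.\<close>

lemma covered_at_image:
  assumes f: "f \<in> {alpha, beta}" and x: "x < 42" and cov: "covered_at x"
  shows "covered_at (f x)"
  unfolding covered_at_def
proof (intro allI impI)
  fix T assume T: "T \<subseteq> {..<42}" "card T = 3" "f x \<in> T"
  have inj: "inj_on f {..<42}" and surj: "f ` {..<42} = {..<42}"
    using f bij_betw_alpha bij_betw_beta by (auto simp: bij_betw_def)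
  obtain U where U: "U \<subseteq> {..<42}" "T = f ` U"
    using T(1) surj by (metis subset_imageE)
  have "x \<in> U"
    using T(3) U x inj by (simp add: inj_on_image_mem_iff)
  moreover have "card U = 3"
    using T(2) U inj by (metis card_image inj_on_subset)
  ultimately obtain B where "B \<in> blocks" "U \<subseteq> B"
    using cov U(1) by (auto simp: covered_at_def)
  then show "\<exists>B\<in>blocks. T \<subseteq> B"
    using image_in_blocks[OF f] U(2) by blast
qed

lemma covered_at_all:
  assumes "x < 42"
  shows "covered_at x"
proof -
  have "x \<in> set (concat (map (orbit [alpha, beta]) [0, 18, 24]))"
    using assms by (intro bspec[OF point_orbits]) simp
  then obtain x0 where x0: "x0 \<in> set [0, 18, 24]" and x: "x \<in> set (orbit [alpha, beta] x0)"
    unfolding set_concat set_map by blast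
  have "covered_at x0"
    using x0 count_and_covers_block_orbits
    by (auto simp: count_and_covers_def intro: covered_at_if_covers_at)
  from x have "x < 42 \<and> covered_at x"
  proof (rule orbit_induct)
    show "x0 < 42 \<and> covered_at x0"
      using x0 \<open>covered_at x0\<close> by auto
  next
    fix f z assume "f \<in> set [alpha, beta]" "z < 42 \<and> covered_at z"
    then show "f z < 42 \<and> covered_at (f z)"
      using covered_at_image[of f z] bij_betw_alpha bij_betw_beta
      by (auto simp: bij_betw_def)
  qed
  then show ?thesis by simp
qed

theorem theorem3: "\<exists>(X :: nat set) (\<B> :: nat set set). steiner_system 3 6 42 X \<B>"
proof -
  have "steiner_system 3 6 42 {..<42} blocks"
  proof (rule steiner_system_if_covers)
    fix T :: "nat set" assume T: "T \<subseteq> {..<42}" "card T = 3"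
    then obtain x where "x \<in> T" by fastforce
    with T show "\<exists>B\<in>blocks. T \<subseteq> B"
      using covered_at_all[of x] by (auto simp: covered_at_def)
  next
    have "(6 choose 3) = (20::nat)" "(42 choose 3) = (11480::nat)"
      by (simp_all add: binomial_fact_lemma eval_nat_numeral)
    then show "card blocks * (6 choose 3) \<le> 42 choose 3"
      using card_blocks by simp
  qed (use finite_blocks blocks_wf in auto)
  then show ?thesis by blast
qed

end
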